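(* Let $2\le p<q\le n$. (1) For integers $1\le i_q<q$, $1\le i_p<p$, the element $t_q^{i_q}\cdot t_p^{i_p}$ of $S_n$ is transformed into the canonical form $t_2^{i_2}t_3^{i_3}\cdots t_n^{i_n}$ (standard OGS) by the exchange laws $$ t_{q}^{i_{q}}\cdot t_{p}^{i_{p}}=\begin{cases} t_{i_{q}+i_{p}}^{i_q}\cdot t_{p+i_{q}}^{i_{p}}\cdot t_{q}^{i_{q}} & \text{if } q-i_{q}\geq p, \\ t_{i_{q}}^{p+i_{q}-q}\cdot t_{i_{q}+i_{p}}^{q-p}\cdot t_{q}^{i_{q}+i_{p}} & \text{if } i_{p}\leq q-i_{q}\leq p, \\ t_{p+i_{q}-q}^{i_{q}+i_{p}-q}\cdot t_{i_{q}}^{p-i_{p}}\cdot t_{q}^{i_{q}+i_{p}-p} & \text{if } q-i_{q}\leq i_{p}. \end{cases}$$ (2) For integers $1\le i_q'<q$, $1\le i_p'<p$, the element $t_{p}^{i_p'}\cdot t_{q}^{i_q'}$ of $S_n$ is transformed into the canonical form $t_{n}^{i_{n}} t_{n-1}^{i_{n-1}}\cdots t_{2}^{i_{2}}$ (dual-standard OGS) by the exchange laws $$ t_{p}^{i_p'}\cdot t_{q}^{i_q'}=\begin{cases} t_{q}^{i_q'}\cdot t_{p+q-i_q'}^{q-i_q'+i_p'}\cdot t_{q-i_q'+p-i_p'}^{p-i_p'} & \text{if } i_q'\geq p, \\ t_{q}^{i_q'+i_p'-p}\cdot t_{q-i_q'+p-i_p'}^{2p-i_p'-i_q'}\cdot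 t_{q-i_q'}^{q-p} & \text{if } p-i_p'\leq i_q'\leq p, \\ t_{q}^{i_q'+i_p'}\cdot t_{q-i_q'}^{q-i_q'-i_p'}\cdot t_{p-i_q'}^{i_p'} & \text{if } i_q'\leq p-i_p'. \end{cases}$$
   Context: $S_n$ is the group of permutations of $\{1,\dots,n\}$, with products taken from left to right: $(\pi_1\cdot\pi_2)(i)=\pi_2(\pi_1(i))$. $s_i$ is the transposition $(i,i+1)$. For $2\le m\le n$, $t_m=s_1s_2\cdots s_{m-1}$, i.e. the permutation with $t_m(1)=m$, $t_m(j)=j-1$ for $2\le j\le m$, $t_m(j)=j$ for $j>m$; it has order $m$. Put $t_1=1$. Every element of $S_n$ has a unique presentation $t_2^{i_2}t_3^{i_3}\cdots t_n^{i_n}$ with $0\le i_k<k$ (standard OGS canonical form), and a unique presentation $t_n^{i_n}t_{n-1}^{i_{n-1}}\cdots t_2^{i_2}$ with $0\le i_k<k$ (dual-standard OGS canonical form). In reading the right-hand sides as canonical forms, adjacent powers of the same $t_k$ are merged, exponents of $t_k$ are reduced modulo $k$, and trivial factors are dropped. *)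

theory Defs
  imports "HOL-Algebra.Sym_Groups"
begin

(* The library group sym_group n multiplies permutations from right to left (by composition);
   here products are taken from left to right. *)
definition lr_sym_group :: "nat \<Rightarrow> (nat \<Rightarrow> nat) monoid" where
  "lr_sym_group n = (sym_group n) \<lparr>mult := (\<lambda>g h. h \<circ> g)\<rparr>"

definition ogs_gen :: "nat \<Rightarrow> nat \<Rightarrow> nat \<Rightarrow> nat" where
  "ogs_gen n m =
     foldr (\<otimes>\<^bsub>lr_sym_group n\<^esub>) (map (\<lambda>i. Transposition.transpose i (i + 1)) [1..<m]) \<one>\<^bsub>lr_sym_group n\<^esub>"

(* A list [(k1, i1), (k2, i2), ...] stands for the formal product t_k1^i1 t_k2^i2 ... *)
definition ogs_prod :: "nat \<Rightarrow> (nat \<times> nat) list \<Rightarrow> nat \<Rightarrow> nat" where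
  "ogs_prod n w =
     foldr (\<otimes>\<^bsub>lr_sym_group n\<^esub>)
       (map (\<lambda>(k, i). ogs_gen n k [^]\<^bsub>lr_sym_group n\<^esub> i) w) \<one>\<^bsub>lr_sym_group n\<^esub>"

fun merge_adjacent :: "(nat \<times> nat) list \<Rightarrow> (nat \<times> nat) list" where
  "merge_adjacent [] = []"
| "merge_adjacent [x] = [x]"
| "merge_adjacent ((k, i) # (l, j) # w) =
     (if k = l then merge_adjacent ((k, i + j) # w)
      else (k, i) # merge_adjacent ((l, j) # w))"

(* Every exponent is 0 modulo 1, so powers of t_1 = 1 are dropped as well. *)
definition ogs_reduce :: "(nat \<times> nat) list \<Rightarrow> (nat \<times> nat) list" where
  "ogs_reduce w =
     filter (\<lambda>(k, i). i \<noteq> 0) (map (\<lambda>(k, i). (k, i mod k)) (merge_adjacent w))"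

(* A canonical form is represented by the list of its nontrivial factors. *)
definition standard_ogs_form :: "nat \<Rightarrow> (nat \<Rightarrow> nat) \<Rightarrow> (nat \<times> nat) list \<Rightarrow> bool" where
  "standard_ogs_form n g w \<longleftrightarrow>
     (\<forall>(k, i) \<in> set w. 2 \<le> k \<and> k \<le> n \<and> 0 < i \<and> i < k) \<and>
     sorted_wrt (<) (map fst w) \<and> ogs_prod n w = g"

definition dual_standard_ogs_form :: "nat \<Rightarrow> (nat \<Rightarrow> nat) \<Rightarrow> (nat \<times> nat) list \<Rightarrow> bool" where
  "dual_standard_ogs_form n g w \<longleftrightarrow>
     (\<forall>(k, i) \<in> set w. 2 \<le> k \<and> k \<le> n \<and> 0 < i \<and> i < k) \<and>
     sorted_wrt (>) (map fst w) \<and> ogs_prod n w = g"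

(* The exchange law u = w: an equality in the group, whose right-hand side reads as the
   canonical form. *)
definition standard_exchange :: "nat \<Rightarrow> (nat \<times> nat) list \<Rightarrow> (nat \<times> nat) list \<Rightarrow> bool" where
  "standard_exchange n u w \<longleftrightarrow>
     ogs_prod n u = ogs_prod n w \<and> standard_ogs_form n (ogs_prod n u) (ogs_reduce w)"

definition dual_standard_exchange :: "nat \<Rightarrow> (nat \<times> nat) list \<Rightarrow> (nat \<times> nat) list \<Rightarrow> bool" where
  "dual_standard_exchange n u w \<longleftrightarrow>
     ogs_prod n u = ogs_prod n w \<and> dual_standard_ogs_form n (ogs_prod n u) (ogs_reduce w)"

lemma lr_sym_group_simps [simp]:
  "carrier (lr_sym_group n) = {g. g permutes {1..n}}"
  "g \<otimes>\<^bsub>lr_sym_group n\<^esub> h = h \<circ> g"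
  "\<one>\<^bsub>lr_sym_group n\<^esub> = id"
  by (simp_all add: lr_sym_group_def sym_group_def)

lemma lr_sym_group_is_group: "group (lr_sym_group n)"
proof (rule groupI)
  fix g assume "g \<in> carrier (lr_sym_group n)"
  then have g: "g permutes {1..n}" by simp
  show "\<exists>h \<in> carrier (lr_sym_group n). h \<otimes>\<^bsub>lr_sym_group n\<^esub> g = \<one>\<^bsub>lr_sym_group n\<^esub>"
    using permutes_inv[OF g] permutes_inv_o(1)[OF g]
    by (intro bexI[of _ "inv_into UNIV g"]) (simp_all only: lr_sym_group_simps mem_Collect_eq)
qed (simp_all add: permutes_compose o_assoc)

lemma ogs_gen_eq:
  assumes "1 \<le> m"
  shows "ogs_gen n m j = (if j = 1 then m else if 2 \<le> j \<and> j \<le> m then j - 1 else j)"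
proof -
  have snoc: "foldr (\<otimes>\<^bsub>lr_sym_group n\<^esub>) (xs @ [x]) id
      = x \<circ> foldr (\<otimes>\<^bsub>lr_sym_group n\<^esub>) xs id" for xs :: "(nat \<Rightarrow> nat) list" and x
    by (induction xs) (simp_all add: o_assoc)
  from assms show ?thesis
  proof (induction m arbitrary: j rule: dec_induct)
    case base
    show ?case by (simp add: ogs_gen_def)
  next
    case (step m)
    have "ogs_gen n (Suc m) = transpose m (Suc m) \<circ> ogs_gen n m"
      unfolding ogs_gen_def lr_sym_group_simps(3) snoc[symmetric] using step.hyps by simp
    then show ?case
      using step.hyps by (simp add: step.IH transpose_def) linarith
  qed
qed

lemma ogs_prod_three:
  "ogs_prod n [(a, i), (b, j), (c, k)] =
     ogs_gen n a [^]\<^bsub>lr_sym_group n\<^esub> i \<otimes>\<^bsub>lr_sym_group n\<^esub>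
     (ogs_gen n b [^]\<^bsub>lr_sym_group n\<^esub> j \<otimes>\<^bsub>lr_sym_group n\<^esub>
      ogs_gen n c [^]\<^bsub>lr_sym_group n\<^esub> k)"
  by (simp add: ogs_prod_def)

end

theory Submission
  imports Defs
begin

text \<open>
  A power \<open>t\<^sub>k\<^sup>i\<close> with \<open>i \<le> k\<close> cuts the first \<open>k\<close> places of a word into two blocks
  \<open>X Y\<close> with \<open>X\<close> of length \<open>i\<close>, and interchanges them: \<open>X Y \<mapsto> Y X\<close>. A left-to-right product
  performs such moves one after the other. Cut the first \<open>q\<close> places into four
  consecutive blocks \<open>A B C D\<close>, of lengths \<open>a\<close>, \<open>b\<close>, \<open>c\<close>, \<open>d\<close>. Then the two factors
  \<open>t\<^sub>a\<^sub>+\<^sub>b\<^sup>a\<close> and \<open>t\<^sub>a\<^sub>+\<^sub>b\<^sub>+\<^sub>c\<^sup>b\<close> perform \<open>A B C D \<mapsto> B A C D \<mapsto> A C B D\<close>, so together they interchange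
  the middle blocks, and a power of \<open>t\<^sub>q\<close> rotates the resulting word cyclically. On the
  other side, \<open>t\<^sub>q\<^sup>i\<close> rotates \<open>A B C D\<close> first, which leaves the cyclic word unchanged, and \<open>t\<^sub>p\<^sup>j\<close> then
  interchanges two of the three arcs \<open>B\<close>, \<open>C\<close> and \<open>D A\<close> of that cyclic word. Three arcs have
  only two cyclic orders, so it does not matter which two are interchanged: the result is the
  cyclic word \<open>A C B D\<close> in every case. The three cases of the standard exchange law are the
  three pairs of arcs, with the place where the resulting cyclic word is cut open:
  \<open>exchange_blocks_no_wrap\<close>, \<open>exchange_blocks_wrap_after_cut\<close> and \<open>exchange_blocks_wrap_before_cut\<close>.

  The dual laws are the inverses of the standard ones: since \<open>t\<^sub>k\<close> has order \<open>k\<close>,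
  inverting a product reverses its factors and replaces each exponent \<open>i\<close> by \<open>k - i\<close>
  (\<open>ogs_prod_inverse_cong\<close>).

  That the right-hand sides read as canonical forms depends on the indices only. Merging
  and reducing preserves the product, and it turns any product whose
  indices are weakly monotone and lie between 1 and \<open>n\<close> into one with strictly monotone indices and
  exponents in the required range (\<open>standard_exchangeI\<close>, \<open>dual_standard_exchangeI\<close>). This covers the
  boundary cases, in which two indices coincide or an exponent vanishes.
\<close>

section \<open>Powers of the generators\<close>

abbreviation gen_pow :: "nat \<Rightarrow> nat \<Rightarrow> nat \<Rightarrow> nat \<Rightarrow> nat" where
  "gen_pow n k i \<equiv> ogs_gen n k [^]\<^bsub>lr_sym_group n\<^esub> i"

lemma ogs_gen_0: "ogs_gen n 0 = id"
  by (simp add: ogs_gen_def)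

text \<open>
  The cyclic shift by \<open>i\<close> of the first \<open>k\<close> places. Allowing \<open>i = k\<close>, where it is the identity,
  makes the formula apply at the boundaries of the exchange laws as well.
\<close>

lemma gen_pow_apply:
  assumes "i \<le> k"
  shows "gen_pow n k i x =
    (if 1 \<le> x \<and> x \<le> k then if i < x then x - i else x + k - i else x)"
  using assms
proof (induction i)
  case 0
  show ?case by simp
next
  case (Suc i)
  then have "1 \<le> k" and "i \<le> k" by simp_all
  with Suc show ?case
    by (simp add: ogs_gen_eq) linarith
qed

lemma gen_pow_order: "gen_pow n k k = id"
  by (intro ext) (simp add: gen_pow_apply)

text \<open>
  The generator is a bijection because its power with exponent \<open>k - 1\<close> is a two-sided inverse.
\<close>

lemma ogs_gen_carrier:
  assumes "k \<le> n"
  shows "ogs_gen n k \<in> carrier (lr_sym_group n)"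
proof (cases "k = 0")
  case True
  then show ?thesis by (simp add: ogs_gen_0 permutes_id)
next
  case False
  have "bij (ogs_gen n k)"
    using False by (intro o_bij[of "gen_pow n k (k - 1)"] ext)
      (auto simp: gen_pow_apply ogs_gen_eq)
  moreover have "ogs_gen n k x = x" if "x \<notin> {1..n}" for x
    using False that assms by (auto simp: ogs_gen_eq)
  ultimately have "ogs_gen n k permutes {1..n}"
    unfolding permutes_def bij_iff by blast
  then show ?thesis by simp
qed

lemma gen_pow_add:
  assumes "k \<le> n"
  shows "gen_pow n k (i + j) = gen_pow n k j \<circ> gen_pow n k i"
  using monoid.nat_pow_mult[OF group.is_monoid[OF lr_sym_group_is_group] ogs_gen_carrier[OF assms], of i j]
  by simp

lemma gen_pow_mod:
  assumes "k \<le> n"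
  shows "gen_pow n k (i mod k) = gen_pow n k i"
proof -
  have "gen_pow n k (k * m) = id" for m
    by (induction m) (simp_all add: gen_pow_add[OF assms] gen_pow_order)
  then have "gen_pow n k (k * (i div k) + i mod k) = gen_pow n k (i mod k)"
    by (simp only: gen_pow_add[OF assms]) simp
  then show ?thesis by (simp only: mult_div_mod_eq)
qed

section \<open>Formal products and their inverses\<close>

lemma ogs_prod_Nil [simp]: "ogs_prod n [] = id"
  by (simp add: ogs_prod_def)

lemma ogs_prod_Cons [simp]: "ogs_prod n ((k, i) # w) = ogs_prod n w \<circ> gen_pow n k i"
  by (simp add: ogs_prod_def)

lemma ogs_prod_append: "ogs_prod n (v @ w) = ogs_prod n w \<circ> ogs_prod n v"
  by (induction v) (auto simp: o_assoc)

text \<open>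
  The formal inverse of a product: since \<open>t\<^sub>k\<close> has order \<open>k\<close>, the inverse of \<open>t\<^sub>k\<^sup>i\<close> is \<open>t\<^sub>k\<^sup>k\<^sup>-\<^sup>i\<close>, with
  a natural number as exponent when \<open>i \<le> k\<close>.
\<close>

abbreviation inverse_word :: "(nat \<times> nat) list \<Rightarrow> (nat \<times> nat) list" where
  "inverse_word w \<equiv> rev (map (\<lambda>(k, i). (k, k - i)) w)"

lemma ogs_prod_inverse:
  assumes "\<forall>(k, i) \<in> set w. k \<le> n \<and> i \<le> k"
  shows "ogs_prod n w (ogs_prod n (inverse_word w) x) = x"
  using assms
proof (induction w arbitrary: x)
  case (Cons f w)
  obtain k i where f: "f = (k, i)" by fastforce
  have "gen_pow n k i \<circ> gen_pow n k (k - i) = id"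
    using Cons.prems f by (simp add: gen_pow_add[symmetric] gen_pow_order)
  then have "gen_pow n k i (gen_pow n k (k - i) y) = y" for y
    by (simp only: fun_eq_iff comp_apply id_apply)
  moreover have "ogs_prod n w (ogs_prod n (inverse_word w) y) = y" for y
    using Cons.prems by (intro Cons.IH) auto
  ultimately show ?case
    by (simp add: f ogs_prod_append)
qed simp

text \<open>
  Passing to inverses on both sides of a relation. Formal inversion is an involution, so
  \<open>ogs_prod_inverse\<close>, applied to \<open>w\<close> and to its formal inverse, gives a two-sided inverse.
\<close>

lemma ogs_prod_inverse_cong:
  assumes "\<forall>(k, i) \<in> set u \<union> set w. k \<le> n \<and> i \<le> k"
    and "ogs_prod n u = ogs_prod n w"
  shows "ogs_prod n (inverse_word u) = ogs_prod n (inverse_word w)"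
proof
  fix x
  have "(case f of (k, i) \<Rightarrow> (k, k - (k - i))) = f" if "f \<in> set w" for f
    using bspec[OF assms(1), of f] that by (cases f) simp
  then have "inverse_word (inverse_word w) = w"
    by (simp add: rev_map comp_def case_prod_beta map_idI)
  moreover have "\<forall>(k, i) \<in> set (inverse_word w). k \<le> n \<and> i \<le> k"
    using assms(1) by auto
  ultimately have left: "ogs_prod n (inverse_word w) (ogs_prod n w y) = y" for y
    using ogs_prod_inverse[of "inverse_word w" n y] by simp
  have "ogs_prod n w (ogs_prod n (inverse_word u) x) = x"
    using assms(1) ogs_prod_inverse[of u n x] unfolding assms(2) by auto
  then show "ogs_prod n (inverse_word u) x = ogs_prod n (inverse_word w) x"
    using left[of "ogs_prod n (inverse_word u) x"] by simp
qed

section \<open>Reduction to canonical form\<close>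

lemma fst_merge_adjacent: "fst ` set (merge_adjacent w) = fst ` set w"
  by (induction w rule: merge_adjacent.induct) auto

lemma ogs_prod_merge_adjacent:
  assumes "\<forall>(k, i) \<in> set w. k \<le> n"
  shows "ogs_prod n (merge_adjacent w) = ogs_prod n w"
  using assms
  by (induction w rule: merge_adjacent.induct) (auto simp: gen_pow_add o_assoc)

lemma ogs_prod_reduce:
  assumes "\<forall>(k, i) \<in> set w. k \<le> n"
  shows "ogs_prod n (ogs_reduce w) = ogs_prod n w"
proof -
  have drop: "ogs_prod n (filter (\<lambda>(k, i). 0 < i) v) = ogs_prod n v" for v
    by (induction v) auto
  have reduce: "ogs_prod n (map (\<lambda>(k, i). (k, i mod k)) v) = ogs_prod n v"
    if "fst ` set v \<subseteq> {..n}" for v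
    using that by (induction v) (auto simp: gen_pow_mod)
  have "fst ` set (merge_adjacent w) \<subseteq> {..n}"
    using assms by (auto simp: fst_merge_adjacent)
  then show ?thesis
    using assms by (simp add: ogs_reduce_def drop reduce ogs_prod_merge_adjacent)
qed

text \<open>
  In a weakly sorted list equal entries are adjacent, so merging them leaves no repetition.
  The relation \<open>R\<close> is \<open><\<close> for the standard and \<open>>\<close> for the dual forms.
\<close>

lemma sorted_merge_adjacent:
  assumes "transp R" and "sorted_wrt R\<^sup>=\<^sup>= (map fst w)"
  shows "sorted_wrt R (map fst (merge_adjacent w))"
  using assms(2)
proof (induction w rule: merge_adjacent.induct)
  case (3 k i l j w)
  show ?case
  proof (cases "k = l")
    case True
    then show ?thesis using 3 by simp
  next
    case False
    have "R k m" if "m \<in> fst ` set (merge_adjacent ((l, j) # w))" for m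
    proof -
      have "m \<in> fst ` set ((l, j) # w)"
        using that by (simp only: fst_merge_adjacent)
      then have "R k l" and "R l m \<or> l = m"
        using 3 False by auto
      then show ?thesis
        using assms(1) by (auto dest: transpD)
    qed
    then show ?thesis using 3 False by simp
  qed
qed simp_all

lemma sorted_reduce:
  assumes "transp R" and "sorted_wrt R\<^sup>=\<^sup>= (map fst w)"
  shows "sorted_wrt R (map fst (ogs_reduce w))"
proof -
  have "sorted_wrt R (map fst (map (\<lambda>(k, i). (k, i mod k)) (merge_adjacent w)))"
    using sorted_merge_adjacent[OF assms] by (simp add: comp_def case_prod_beta)
  then show ?thesis
    unfolding ogs_reduce_def by (simp only: sorted_wrt_map sorted_wrt_filter)
qed

text \<open>
  An index 1 cannot survive, since every exponent vanishes modulo 1.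
\<close>

lemma reduce_exponents:
  assumes "\<forall>(k, i) \<in> set w. 1 \<le> k \<and> k \<le> n"
  shows "\<forall>(k, i) \<in> set (ogs_reduce w). 2 \<le> k \<and> k \<le> n \<and> 0 < i \<and> i < k"
proof -
  have range: "1 \<le> k \<and> k \<le> n" if "(k, i) \<in> set (merge_adjacent w)" for k i
  proof -
    have "k \<in> fst ` set w"
      using that fst_merge_adjacent[of w] by force
    then show ?thesis using assms by auto
  qed
  have "2 \<le> k" if "1 \<le> k" and "0 < i mod k" for i k :: nat
    using that by (cases "k = 1") auto
  with range show ?thesis
    by (fastforce simp: ogs_reduce_def)
qed

text \<open>
  To prove an exchange law it suffices to compare the products and to inspect the indices,
  because reduction brings the exponents into range.
\<close>

lemma standard_exchangeI:
  assumes "ogs_prod n u = ogs_prod n w"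
    and "\<forall>(k, i) \<in> set w. 1 \<le> k \<and> k \<le> n" and "sorted_wrt (\<le>) (map fst w)"
  shows "standard_exchange n u w"
proof -
  have "((<)\<^sup>=\<^sup>= :: nat \<Rightarrow> nat \<Rightarrow> bool) = (\<le>)" by (auto simp: fun_eq_iff)
  then have "sorted_wrt (<) (map fst (ogs_reduce w))"
    using assms(3) by (intro sorted_reduce) auto
  moreover have "ogs_prod n (ogs_reduce w) = ogs_prod n w"
    using assms(2) by (intro ogs_prod_reduce) auto
  ultimately show ?thesis
    using assms(1) reduce_exponents[OF assms(2)]
    by (simp add: standard_exchange_def standard_ogs_form_def)
qed

lemma dual_standard_exchangeI:
  assumes "ogs_prod n u = ogs_prod n w"
    and "\<forall>(k, i) \<in> set w. 1 \<le> k \<and> k \<le> n" and "sorted_wrt (\<ge>) (map fst w)"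
  shows "dual_standard_exchange n u w"
proof -
  have "((>)\<^sup>=\<^sup>= :: nat \<Rightarrow> nat \<Rightarrow> bool) = (\<ge>)" by (auto simp: fun_eq_iff)
  then have "sorted_wrt (>) (map fst (ogs_reduce w))"
    using assms(3) by (intro sorted_reduce) auto
  moreover have "ogs_prod n (ogs_reduce w) = ogs_prod n w"
    using assms(2) by (intro ogs_prod_reduce) auto
  ultimately show ?thesis
    using assms(1) reduce_exponents[OF assms(2)]
    by (simp add: dual_standard_exchange_def dual_standard_ogs_form_def)
qed

section \<open>Interchanging two blocks of a cyclic word\<close>

text \<open>
  Left: \<open>A B C D \<mapsto> B C D A \<mapsto> C B D A\<close>. Right: \<open>A B C D \<mapsto> B A C D \<mapsto> A C B D \<mapsto> C B D A\<close>. On each block both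
  sides are translations, so it suffices to compare them block by block. The block \<open>A\<close>, which
  the first rotation moves to the end, lies outside the range \<open>B C\<close> of the second.
\<close>

lemma exchange_blocks_no_wrap:
  "ogs_prod n [(a + b + c + d, a), (b + c, b)] =
    ogs_prod n [(a + b, a), (a + b + c, b), (a + b + c + d, a)]"
proof
  fix x
  consider "x = 0" | "1 \<le> x" "x \<le> a" | "a < x" "x \<le> a + b"
    | "a + b < x" "x \<le> a + b + c" | "a + b + c < x" "x \<le> a + b + c + d"
    | "a + b + c + d < x"
    by linarith
  then show "ogs_prod n [(a + b + c + d, a), (b + c, b)] x =
    ogs_prod n [(a + b, a), (a + b + c, b), (a + b + c + d, a)] x"
    by cases (auto simp: gen_pow_apply)
qed

text \<open>
  Left: \<open>A B C D \<mapsto> C D A B \<mapsto> D A C B\<close>. Right: \<open>A C B D \<mapsto> D A C B\<close> after the interchange of \<open>B\<close> and \<open>C\<close>.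
  The range \<open>C D A\<close> of the second rotation reaches into the part \<open>A B\<close> that the first one moves to
  the end, and it is cut after \<open>C\<close>, thus before that part begins.
\<close>

lemma exchange_blocks_wrap_after_cut:
  "ogs_prod n [(a + b + c + d, a + b), (c + d + a, c)] =
    ogs_prod n [(a + b, a), (a + b + c, b), (a + b + c + d, a + b + c)]"
proof
  fix x
  consider "x = 0" | "1 \<le> x" "x \<le> a" | "a < x" "x \<le> a + b"
    | "a + b < x" "x \<le> a + b + c" | "a + b + c < x" "x \<le> a + b + c + d"
    | "a + b + c + d < x"
    by linarith
  then show "ogs_prod n [(a + b + c + d, a + b), (c + d + a, c)] x =
    ogs_prod n [(a + b, a), (a + b + c, b), (a + b + c + d, a + b + c)] x"
    by cases (auto simp: gen_pow_apply)
qed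

text \<open>
  Left: \<open>A B C D \<mapsto> D A B C \<mapsto> B D A C\<close>. Right: \<open>A C B D \<mapsto> B D A C\<close> after the interchange of \<open>B\<close> and \<open>C\<close>.
  The range \<open>D A B\<close> of the second rotation is cut after \<open>A\<close>, thus inside the part \<open>A B C\<close> that the
  first one moves to the end.
\<close>

lemma exchange_blocks_wrap_before_cut:
  "ogs_prod n [(a + b + c + d, a + b + c), (d + a + b, d + a)] =
    ogs_prod n [(a + b, a), (a + b + c, b), (a + b + c + d, a + c)]"
proof
  fix x
  consider "x = 0" | "1 \<le> x" "x \<le> a" | "a < x" "x \<le> a + b"
    | "a + b < x" "x \<le> a + b + c" | "a + b + c < x" "x \<le> a + b + c + d"
    | "a + b + c + d < x"
    by linarith
  then show "ogs_prod n [(a + b + c + d, a + b + c), (d + a + b, d + a)] x =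
    ogs_prod n [(a + b, a), (a + b + c, b), (a + b + c + d, a + c)] x"
    by cases (auto simp: gen_pow_apply)
qed

section \<open>The exchange laws\<close>

text \<open>
  In each case the indices and exponents determine the four block lengths, which are
  the arguments passed to the corresponding block lemma.
\<close>

lemma exchange_no_wrap:
  assumes "j \<le> p" and "p + i \<le> q"
  shows "ogs_prod n [(q, i), (p, j)] = ogs_prod n [(i + j, i), (p + i, j), (q, i)]"
proof -
  have "i + j + (p - j) + (q - (p + i)) = q" "j + (p - j) = p" "i + j + (p - j) = p + i"
    using assms by auto
  then show ?thesis
    using exchange_blocks_no_wrap[of n i j "p - j" "q - (p + i)"] by (simp only:)
qed

lemma exchange_wrap_after_cut:
  assumes "p \<le> q" and "i + j \<le> q" and "q \<le> p + i"
  shows "ogs_prod n [(q, i), (p, j)] = ogs_prod n [(i, p + i - q), (i + j, q - p), (q, i + j)]"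
proof -
  have "p + i - q + (q - p) = i" "i + j + (q - (i + j)) = q"
    "j + (q - (i + j)) + (p + i - q) = p"
    using assms by auto
  then show ?thesis
    using exchange_blocks_wrap_after_cut[of n "p + i - q" "q - p" j "q - (i + j)"] by (simp only:)
qed

lemma exchange_wrap_before_cut:
  assumes "p \<le> q" and "q \<le> i + j" and "i \<le> q" and "j \<le> p"
  shows "ogs_prod n [(q, i), (p, j)] =
    ogs_prod n [(p + i - q, i + j - q), (i, p - j), (q, i + j - p)]"
proof -
  have "i + j - q + (p - j) = p + i - q" "p + i - q + (q - p) = i" "i + (q - i) = q"
    "q - i + (i + j - q) = j" "j + (p - j) = p" "i + j - q + (q - p) = i + j - p"
    using assms by auto
  then show ?thesis
    using exchange_blocks_wrap_before_cut[of n "i + j - q" "p - j" "q - p" "q - i"] by (simp only:)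
qed

text \<open>
  The formal inverse of the standard law for the exponents \<open>q - i\<close> and \<open>p - j\<close>; this substitution
  turns the case distinction of the standard laws into that of the dual laws.
\<close>

lemma dual_exchange_no_wrap:
  assumes "j \<le> p" and "p \<le> i" and "i \<le> q" and "q \<le> n"
  shows "ogs_prod n [(p, j), (q, i)] =
    ogs_prod n [(q, i), (p + q - i, q - i + j), (q - i + p - j, p - j)]"
proof -
  let ?u = "[(q, q - i), (p, p - j)]"
  let ?w = "[(q - i + (p - j), q - i), (p + (q - i), p - j), (q, q - i)]"
  have "ogs_prod n (inverse_word ?u) = ogs_prod n (inverse_word ?w)"
    by (rule ogs_prod_inverse_cong[OF _ exchange_no_wrap]) (use assms in auto)
  moreover have "inverse_word ?u = [(p, j), (q, i)]"
    using assms by simp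
  moreover have "inverse_word ?w =
      [(q, i), (p + q - i, q - i + j), (q - i + p - j, p - j)]"
    using assms by simp
  ultimately show ?thesis by (simp only:)
qed

lemma dual_exchange_wrap_after_cut:
  assumes "p - j \<le> i" and "i \<le> p" and "j \<le> p" and "p \<le> q" and "q \<le> n"
  shows "ogs_prod n [(p, j), (q, i)] =
    ogs_prod n [(q, i + j - p), (q - i + p - j, 2 * p - j - i), (q - i, q - p)]"
proof -
  let ?u = "[(q, q - i), (p, p - j)]"
  let ?w = "[(q - i, p + (q - i) - q), (q - i + (p - j), q - p), (q, q - i + (p - j))]"
  have "ogs_prod n (inverse_word ?u) = ogs_prod n (inverse_word ?w)"
    by (rule ogs_prod_inverse_cong[OF _ exchange_wrap_after_cut]) (use assms in auto)
  moreover have "inverse_word ?u = [(p, j), (q, i)]"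
    using assms by simp
  moreover have "inverse_word ?w =
      [(q, i + j - p), (q - i + p - j, 2 * p - j - i), (q - i, q - p)]"
    using assms by simp
  ultimately show ?thesis by (simp only:)
qed

lemma dual_exchange_wrap_before_cut:
  assumes "i \<le> p - j" and "j \<le> p" and "p \<le> q" and "q \<le> n"
  shows "ogs_prod n [(p, j), (q, i)] =
    ogs_prod n [(q, i + j), (q - i, q - i - j), (p - i, j)]"
proof -
  let ?u = "[(q, q - i), (p, p - j)]"
  let ?w = "[(p + (q - i) - q, q - i + (p - j) - q), (q - i, p - (p - j)), (q, q - i + (p - j) - p)]"
  have "ogs_prod n (inverse_word ?u) = ogs_prod n (inverse_word ?w)"
    by (rule ogs_prod_inverse_cong[OF _ exchange_wrap_before_cut]) (use assms in auto)
  moreover have "inverse_word ?u = [(p, j), (q, i)]"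
    using assms by simp
  moreover have "inverse_word ?w =
      [(q, i + j), (q - i, q - i - j), (p - i, j)]"
    using assms by simp
  ultimately show ?thesis by (simp only:)
qed

theorem proposition3p4:
  fixes n p q :: nat
  assumes "2 \<le> p" and "p < q" and "q \<le> n"
  shows
    "(\<forall>iq ip :: nat. 1 \<le> iq \<and> iq < q \<and> 1 \<le> ip \<and> ip < p \<longrightarrow>
        (q - iq \<ge> p \<longrightarrow>
           standard_exchange n [(q, iq), (p, ip)]
             [(iq + ip, iq), (p + iq, ip), (q, iq)]) \<and>
        (ip \<le> q - iq \<and> q - iq \<le> p \<longrightarrow>
           standard_exchange n [(q, iq), (p, ip)]
             [(iq, p + iq - q), (iq + ip, q - p), (q, iq + ip)]) \<and>
        (q - iq \<le> ip \<longrightarrow>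
           standard_exchange n [(q, iq), (p, ip)]
             [(p + iq - q, iq + ip - q), (iq, p - ip), (q, iq + ip - p)])) \<and>
     (\<forall>iq' ip' :: nat. 1 \<le> iq' \<and> iq' < q \<and> 1 \<le> ip' \<and> ip' < p \<longrightarrow>
        (iq' \<ge> p \<longrightarrow>
           dual_standard_exchange n [(p, ip'), (q, iq')]
             [(q, iq'), (p + q - iq', q - iq' + ip'), (q - iq' + p - ip', p - ip')]) \<and>
        (p - ip' \<le> iq' \<and> iq' \<le> p \<longrightarrow>
           dual_standard_exchange n [(p, ip'), (q, iq')]
             [(q, iq' + ip' - p), (q - iq' + p - ip', 2 * p - ip' - iq'), (q - iq', q - p)]) \<and>
        (iq' \<le> p - ip' \<longrightarrow>
           dual_standard_exchange n [(p, ip'), (q, iq')]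
             [(q, iq' + ip'), (q - iq', q - iq' - ip'), (p - iq', ip')]))"
proof (intro conjI allI impI; elim conjE)
  fix iq ip :: nat
  assume *: "1 \<le> iq" "iq < q" "1 \<le> ip" "ip < p" "p \<le> q - iq"
  show "standard_exchange n [(q, iq), (p, ip)] [(iq + ip, iq), (p + iq, ip), (q, iq)]"
    by (rule standard_exchangeI[OF exchange_no_wrap]) (use assms * in auto)
next
  fix iq ip :: nat
  assume *: "1 \<le> iq" "iq < q" "1 \<le> ip" "ip < p" "ip \<le> q - iq" "q - iq \<le> p"
  show "standard_exchange n [(q, iq), (p, ip)]
      [(iq, p + iq - q), (iq + ip, q - p), (q, iq + ip)]"
    by (rule standard_exchangeI[OF exchange_wrap_after_cut]) (use assms * in auto)
next
  fix iq ip :: nat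
  assume *: "1 \<le> iq" "iq < q" "1 \<le> ip" "ip < p" "q - iq \<le> ip"
  show "standard_exchange n [(q, iq), (p, ip)]
      [(p + iq - q, iq + ip - q), (iq, p - ip), (q, iq + ip - p)]"
    by (rule standard_exchangeI[OF exchange_wrap_before_cut]) (use assms * in auto)
next
  fix iq' ip' :: nat
  assume *: "1 \<le> iq'" "iq' < q" "1 \<le> ip'" "ip' < p" "p \<le> iq'"
  show "dual_standard_exchange n [(p, ip'), (q, iq')]
      [(q, iq'), (p + q - iq', q - iq' + ip'), (q - iq' + p - ip', p - ip')]"
    by (rule dual_standard_exchangeI[OF dual_exchange_no_wrap]) (use assms * in auto)
next
  fix iq' ip' :: nat
  assume *: "1 \<le> iq'" "iq' < q" "1 \<le> ip'" "ip' < p" "p - ip' \<le> iq'" "iq' \<le> p"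
  show "dual_standard_exchange n [(p, ip'), (q, iq')]
      [(q, iq' + ip' - p), (q - iq' + p - ip', 2 * p - ip' - iq'), (q - iq', q - p)]"
    by (rule dual_standard_exchangeI[OF dual_exchange_wrap_after_cut]) (use assms * in auto)
next
  fix iq' ip' :: nat
  assume *: "1 \<le> iq'" "iq' < q" "1 \<le> ip'" "ip' < p" "iq' \<le> p - ip'"
  show "dual_standard_exchange n [(p, ip'), (q, iq')]
      [(q, iq' + ip'), (q - iq', q - iq' - ip'), (p - iq', ip')]"
    by (rule dual_standard_exchangeI[OF dual_exchange_wrap_before_cut]) (use assms * in auto)
qed

end
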